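(* Let $n,N\ge1$ be integers, let $A_1,\ldots,A_n\in\mathbb{S}^N_{++}$, let $\mu>0$, and let $\lambda_1,\ldots,\lambda_n>0$ with $\sum_{i=1}^n\lambda_i=1$. Write $\boldsymbol{A}=(A_1,\ldots,A_n)$, $\boldsymbol{A}^{-1}=(A_1^{-1},\ldots,A_n^{-1})$ and $\boldsymbol{\lambda}=(\lambda_1,\ldots,\lambda_n)$. Then $$\big[\mathcal{R}_{\mu}(\boldsymbol{A},\boldsymbol{\lambda})\big]^{-1}=\mathcal{R}_{\mu^{-1}}(\boldsymbol{A}^{-1},\boldsymbol{\lambda}),$$ i.e., $$\Big[\Big(\lambda_1(A_1+\mu^{-1}\mathrm{Id})^{-1}+\cdots+\lambda_n(A_n+\mu^{-1}\mathrm{Id})^{-1}\Big)^{-1}-\mu^{-1}\mathrm{Id}\Big]^{-1}=\Big(\lambda_1(A_1^{-1}+\mu\,\mathrm{Id})^{-1}+\cdots+\lambda_n(A_n^{-1}+\mu\,\mathrm{Id})^{-1}\Big)^{-1}-\mu\,\mathrm{Id}.$$ In particular, for $\mu=1$, $[\mathcal{R}_{1}(\boldsymbol{A},\boldsymbol{\lambda})]^{-1}=\mathcal{R}_{1}(\boldsymbol{A}^{-1},\boldsymbol{\lambda})$.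
   Context: $\mathbb{S}^N_{++}$ is the set of real symmetric positive definite $N\times N$ matrices; $\mathrm{Id}$ is the $N\times N$ identity matrix. For a tuple $\boldsymbol{A}=(A_1,\ldots,A_n)$ of real symmetric positive semidefinite $N\times N$ matrices, weights $\boldsymbol{\lambda}$ as in the claim and $\mu>0$, the resolvent average is $$\mathcal{R}_{\mu}(\boldsymbol{A},\boldsymbol{\lambda})=\big[\lambda_1(A_1+\mu^{-1}\mathrm{Id})^{-1}+\cdots+\lambda_n(A_n+\mu^{-1}\mathrm{Id})^{-1}\big]^{-1}-\mu^{-1}\mathrm{Id}.$$ *)

theory Defs
  imports "HOL-Analysis.Analysis"
begin

definition pos_def_matrices :: "(real^'N^'N) set" where
  "pos_def_matrices = {A. transpose A = A \<and> (\<forall>x. x \<noteq> 0 \<longrightarrow> x \<bullet> (A *v x) > 0)}"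

(* Tuples and weights are functions on nat of which only the values at 1, ..., n matter. *)

definition weighted_resolvent_sum ::
    "real \<Rightarrow> nat \<Rightarrow> (nat \<Rightarrow> real^'N^'N) \<Rightarrow> (nat \<Rightarrow> real) \<Rightarrow> real^'N^'N" where
  "weighted_resolvent_sum \<mu> n A l =
     (\<Sum>i = 1..n. l i *\<^sub>R matrix_inv (A i + inverse \<mu> *\<^sub>R mat 1))"

definition resolvent_average ::
    "real \<Rightarrow> nat \<Rightarrow> (nat \<Rightarrow> real^'N^'N) \<Rightarrow> (nat \<Rightarrow> real) \<Rightarrow> real^'N^'N" where
  "resolvent_average \<mu> n A l =
     matrix_inv (weighted_resolvent_sum \<mu> n A l) - inverse \<mu> *\<^sub>R mat 1"

(* matrix_inv is total and unspecified on singular matrices; this says that every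
   inverse written in the resolvent average really exists. *)
definition resolvent_average_exists ::
    "real \<Rightarrow> nat \<Rightarrow> (nat \<Rightarrow> real^'N^'N) \<Rightarrow> (nat \<Rightarrow> real) \<Rightarrow> bool" where
  "resolvent_average_exists \<mu> n A l \<longleftrightarrow>
     (\<forall>i\<in>{1..n}. invertible (A i + inverse \<mu> *\<^sub>R mat 1)) \<and>
     invertible (weighted_resolvent_sum \<mu> n A l)"

end

theory Submission
  imports Defs
begin

text \<open>Write \<open>c = \<mu>\<^sup>-\<^sup>1\<close>, \<open>S = \<Sum>\<^sub>i \<lambda>\<^sub>i (A\<^sub>i + c Id)\<^sup>-\<^sup>1\<close> and
  \<open>T = \<Sum>\<^sub>i \<lambda>\<^sub>i (A\<^sub>i\<^sup>-\<^sup>1 + \<mu> Id)\<^sup>-\<^sup>1\<close>. The identity \<open>(A\<^sup>-\<^sup>1 + \<mu> Id)\<^sup>-\<^sup>1 = c Id - c\<^sup>2 (A + c Id)\<^sup>-\<^sup>1\<close>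
  and \<open>\<Sum>\<^sub>i \<lambda>\<^sub>i = 1\<close> give \<open>T = c Id - c\<^sup>2 S\<close>. Hence \<open>S\<^sup>-\<^sup>1 - c Id = \<mu> S\<^sup>-\<^sup>1 T\<close> and
  \<open>T\<^sup>-\<^sup>1 - \<mu> Id = c T\<^sup>-\<^sup>1 S\<close>, whose product is the identity. Positive definiteness makes all
  the inverses exist.\<close>

text \<open>\<open>matrix_inv\<close> is a Hilbert choice; invertibility supplies the witness that
  fixes it.\<close>

lemma matrix_inv_mult:
  fixes A :: "real^'N^'N"
  assumes "invertible A"
  shows "A ** matrix_inv A = mat 1" and "matrix_inv A ** A = mat 1"
  using assms someI_ex[of "\<lambda>B. A ** B = mat 1 \<and> B ** A = mat 1"]
  unfolding invertible_def matrix_inv_def by auto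

text \<open>For square matrices a right inverse is two-sided, hence unique. Below, an inverse is
  identified by checking a single product.\<close>

lemma invertible_matrix_inv_eqI:
  fixes A :: "real^'N^'N"
  assumes "A ** B = mat 1"
  shows "invertible A" and "matrix_inv A = B"
proof -
  show inv: "invertible A"
    using assms invertible_right_inverse by blast
  have "matrix_inv A = matrix_inv A ** (A ** B)"
    by (simp add: assms)
  also have "\<dots> = B"
    by (simp add: matrix_mul_assoc matrix_inv_mult[OF inv])
  finally show "matrix_inv A = B" .
qed

lemma matrix_diff_ldistrib:
  fixes A :: "real^'N^'M"
  shows "A ** (B - C) = A ** B - A ** C"
  using matrix_add_ldistrib[of A "B - C" C] by simp

text \<open>A nonzero kernel vector \<open>x\<close> would give
  \<open>x \<bullet> (A *v x) = 0\<close>, so the kernel is trivial.\<close>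

lemma pos_def_matrices_invertible:
  assumes "A \<in> pos_def_matrices"
  shows "invertible A"
proof -
  have "x = 0" if "A *v x = 0" for x
    using assms that by (force simp: pos_def_matrices_def)
  then have "\<exists>B. B ** A = mat 1"
    by (simp add: matrix_left_invertible_ker)
  then show ?thesis
    by (simp add: invertible_left_inverse)
qed

lemma pos_def_matrices_matrix_inv:
  assumes A: "A \<in> pos_def_matrices"
  shows "matrix_inv A \<in> pos_def_matrices"
proof -
  let ?B = "matrix_inv A"
  note AB = matrix_inv_mult[OF pos_def_matrices_invertible[OF A]]
  have "transpose A = A"
    using A by (simp add: pos_def_matrices_def)
  \<comment> \<open>Transposing \<open>?B ** A = mat 1\<close> yields another right inverse of
    \<open>A\<close>; uniqueness then makes \<open>?B\<close> symmetric.\<close>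
  then have "A ** transpose ?B = mat 1"
    by (metis AB(2) matrix_transpose_mul transpose_mat)
  then have "transpose ?B = ?B"
    using invertible_matrix_inv_eqI(2) by metis
  moreover have "x \<bullet> (?B *v x) > 0" if "x \<noteq> 0" for x
  proof -
    \<comment> \<open>With \<open>y = ?B *v x\<close>, the form of \<open>?B\<close> at
      \<open>x\<close> is the form of \<open>A\<close> at \<open>y\<close>.\<close>
    have x: "A *v (?B *v x) = x"
      by (simp add: matrix_vector_mul_assoc AB)
    with that have "?B *v x \<noteq> 0"
      by auto
    then have "(?B *v x) \<bullet> (A *v (?B *v x)) > 0"
      using A by (simp add: pos_def_matrices_def)
    then show ?thesis
      by (simp add: x inner_commute)
  qed
  ultimately show ?thesis
    by (simp add: pos_def_matrices_def)
qed

lemma pos_def_matrices_add: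
  assumes "A \<in> pos_def_matrices" "B \<in> pos_def_matrices"
  shows "A + B \<in> pos_def_matrices"
proof -
  have "transpose (A + B) = transpose A + transpose B"
    by (simp add: transpose_def vec_eq_iff)
  with assms show ?thesis
    by (auto simp: pos_def_matrices_def matrix_vector_mult_add_rdistrib inner_add_right
        intro: add_pos_pos)
qed

lemma pos_def_matrices_scaleR:
  assumes "A \<in> pos_def_matrices" "c > 0"
  shows "c *\<^sub>R A \<in> pos_def_matrices"
  using assms
  by (auto simp: pos_def_matrices_def transpose_scalar simp flip: scaleR_matrix_vector_assoc)

text \<open>The empty sum is the zero matrix, which is not positive definite; for
  \<open>{1..n}\<close> nonemptiness comes from \<open>n \<ge> 1\<close>.\<close>

lemma pos_def_matrices_sum:
  assumes "finite I" "I \<noteq> {}" "\<And>i. i \<in> I \<Longrightarrow> f i \<in> pos_def_matrices"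
  shows "(\<Sum>i\<in>I. f i) \<in> pos_def_matrices"
  using assms by (induction I rule: finite_ne_induct) (auto intro: pos_def_matrices_add)

lemma pos_def_matrices_add_scaled_identity:
  assumes "A \<in> pos_def_matrices" "c > 0"
  shows "A + c *\<^sub>R mat 1 \<in> pos_def_matrices"
proof -
  have "mat 1 \<in> pos_def_matrices"
    by (simp add: pos_def_matrices_def)
  with assms show ?thesis
    by (intro pos_def_matrices_add pos_def_matrices_scaleR)
qed

text \<open>Positive shifts, inverses, positive multiples and nonempty sums all stay within the
  positive definite matrices.\<close>

lemma resolvent_average_exists_pos_def:
  assumes "n \<ge> 1" "\<mu> > 0"
    and "\<And>i. i \<in> {1..n} \<Longrightarrow> A i \<in> pos_def_matrices"
    and "\<And>i. i \<in> {1..n} \<Longrightarrow> l i > 0"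
  shows "resolvent_average_exists \<mu> n A l"
proof -
  have shifted: "A i + inverse \<mu> *\<^sub>R mat 1 \<in> pos_def_matrices" if "i \<in> {1..n}" for i
    using assms that by (intro pos_def_matrices_add_scaled_identity) auto
  have "weighted_resolvent_sum \<mu> n A l \<in> pos_def_matrices"
    unfolding weighted_resolvent_sum_def using assms shifted
    by (intro pos_def_matrices_sum pos_def_matrices_scaleR pos_def_matrices_matrix_inv) auto
  with shifted show ?thesis
    by (simp add: resolvent_average_exists_def pos_def_matrices_invertible)
qed

lemma matrix_inv_add_scaled_identity:
  fixes A :: "real^'N^'N"
  assumes "invertible A" "invertible (A + inverse \<mu> *\<^sub>R mat 1)" "\<mu> \<noteq> 0"
  shows "matrix_inv (matrix_inv A + \<mu> *\<^sub>R mat 1) =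
    inverse \<mu> *\<^sub>R mat 1 - (inverse \<mu> * inverse \<mu>) *\<^sub>R matrix_inv (A + inverse \<mu> *\<^sub>R mat 1)"
proof (rule invertible_matrix_inv_eqI(2))
  let ?B = "matrix_inv A" and ?C = "A + inverse \<mu> *\<^sub>R mat 1"
  let ?D = "matrix_inv ?C"
  \<comment> \<open>The factor \<open>?C\<close> on the right cancels against \<open>?D\<close>, so
    the product with the claimed inverse becomes \<open>inverse \<mu> *\<^sub>R (?B + \<mu>
    *\<^sub>R mat 1) - inverse \<mu> *\<^sub>R ?B\<close>, the identity.\<close>
  have factor: "?B + \<mu> *\<^sub>R mat 1 = \<mu> *\<^sub>R ?B ** ?C"
    using assms by (simp add: matrix_add_ldistrib matrix_scalar_ac matrix_inv_mult
        flip: scalar_matrix_assoc)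
  have "(?B + \<mu> *\<^sub>R mat 1) ** ?D = \<mu> *\<^sub>R ?B"
    by (simp add: factor matrix_inv_mult[OF assms(2)] flip: matrix_mul_assoc)
  moreover have "(?B + \<mu> *\<^sub>R mat 1) ** (inverse \<mu> *\<^sub>R mat 1 - (inverse \<mu> * inverse \<mu>) *\<^sub>R ?D) =
      inverse \<mu> *\<^sub>R (?B + \<mu> *\<^sub>R mat 1)
      - (inverse \<mu> * inverse \<mu>) *\<^sub>R ((?B + \<mu> *\<^sub>R mat 1) ** ?D)"
    by (simp only: matrix_diff_ldistrib matrix_scalar_ac matrix_mul_rid flip: scalar_matrix_assoc)
  ultimately show "(?B + \<mu> *\<^sub>R mat 1) **
      (inverse \<mu> *\<^sub>R mat 1 - (inverse \<mu> * inverse \<mu>) *\<^sub>R ?D) = mat 1"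
    using assms(3) by (simp add: scaleR_right_distrib)
qed

text \<open>The formula for a single matrix is affine in the resolvent, so averaging preserves it:
  weights of sum 1 leave the constant term unchanged.\<close>

lemma weighted_resolvent_sum_matrix_inv:
  assumes "\<mu> \<noteq> 0" "(\<Sum>i = 1..n. l i) = 1"
    and "\<And>i. i \<in> {1..n} \<Longrightarrow> invertible (A i)"
    and "\<And>i. i \<in> {1..n} \<Longrightarrow> invertible (A i + inverse \<mu> *\<^sub>R mat 1)"
  shows "weighted_resolvent_sum (inverse \<mu>) n (\<lambda>i. matrix_inv (A i)) l =
    inverse \<mu> *\<^sub>R mat 1 - (inverse \<mu> * inverse \<mu>) *\<^sub>R weighted_resolvent_sum \<mu> n A l"
proof -
  let ?D = "\<lambda>i. matrix_inv (A i + inverse \<mu> *\<^sub>R mat 1)"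
  have "weighted_resolvent_sum (inverse \<mu>) n (\<lambda>i. matrix_inv (A i)) l =
      (\<Sum>i = 1..n. l i *\<^sub>R (inverse \<mu> *\<^sub>R mat 1 - (inverse \<mu> * inverse \<mu>) *\<^sub>R ?D i))"
    unfolding weighted_resolvent_sum_def inverse_inverse_eq
    using assms by (intro sum.cong refl) (simp add: matrix_inv_add_scaled_identity)
  also have "\<dots> = (\<Sum>i = 1..n. l i) *\<^sub>R inverse \<mu> *\<^sub>R mat 1
      - (inverse \<mu> * inverse \<mu>) *\<^sub>R (\<Sum>i = 1..n. l i *\<^sub>R ?D i)"
    by (simp add: scaleR_diff_right sum_subtractf scaleR_sum_left scaleR_sum_right
        sum_distrib_left mult_ac)
  finally show ?thesis
    by (simp only: assms(2) weighted_resolvent_sum_def scaleR_one)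
qed

lemma resolvent_average_mult:
  assumes "n \<ge> 1" "\<mu> > 0" "(\<Sum>i = 1..n. l i) = 1"
    and A: "\<And>i. i \<in> {1..n} \<Longrightarrow> A i \<in> pos_def_matrices"
    and l: "\<And>i. i \<in> {1..n} \<Longrightarrow> l i > 0"
  shows "resolvent_average \<mu> n A l **
    resolvent_average (inverse \<mu>) n (\<lambda>i. matrix_inv (A i)) l = mat 1"
proof -
  let ?S = "weighted_resolvent_sum \<mu> n A l"
  let ?T = "weighted_resolvent_sum (inverse \<mu>) n (\<lambda>i. matrix_inv (A i)) l"
  have exA: "resolvent_average_exists \<mu> n A l"
    using assms by (intro resolvent_average_exists_pos_def) auto
  have "resolvent_average_exists (inverse \<mu>) n (\<lambda>i. matrix_inv (A i)) l"
    using assms by (intro resolvent_average_exists_pos_def pos_def_matrices_matrix_inv) auto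
  with exA have S: "invertible ?S" and T: "invertible ?T"
    by (simp_all add: resolvent_average_exists_def)
  have T_eq: "?T = inverse \<mu> *\<^sub>R mat 1 - (inverse \<mu> * inverse \<mu>) *\<^sub>R ?S"
    using assms exA by (intro weighted_resolvent_sum_matrix_inv)
      (auto simp: resolvent_average_exists_def pos_def_matrices_invertible)
  \<comment> \<open>Multiplying \<open>T_eq\<close> by the inverse of \<open>?S\<close> produces
    \<open>inverse \<mu>\<close> times the resolvent average of \<open>A\<close>.\<close>
  have "matrix_inv ?S ** ?T =
      matrix_inv ?S ** (inverse \<mu> *\<^sub>R mat 1 - (inverse \<mu> * inverse \<mu>) *\<^sub>R ?S)"
    by (simp only: T_eq)
  also have "\<dots> = inverse \<mu> *\<^sub>R matrix_inv ?S - (inverse \<mu> * inverse \<mu>) *\<^sub>R mat 1"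
    by (simp add: matrix_diff_ldistrib matrix_scalar_ac matrix_inv_mult[OF S]
        flip: scalar_matrix_assoc)
  finally have R: "resolvent_average \<mu> n A l = \<mu> *\<^sub>R (matrix_inv ?S ** ?T)"
    using assms(2) by (simp add: resolvent_average_def scaleR_diff_right)
  \<comment> \<open>Here the left side is the identity; expanding the right side and scaling by
    \<open>\<mu>\<close> isolates \<open>matrix_inv ?T - \<mu> *\<^sub>R mat 1\<close>.\<close>
  have "matrix_inv ?T ** ?T =
      matrix_inv ?T ** (inverse \<mu> *\<^sub>R mat 1 - (inverse \<mu> * inverse \<mu>) *\<^sub>R ?S)"
    by (simp only: T_eq)
  also have "\<dots> = inverse \<mu> *\<^sub>R matrix_inv ?T
      - (inverse \<mu> * inverse \<mu>) *\<^sub>R (matrix_inv ?T ** ?S)"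
    by (simp add: matrix_diff_ldistrib matrix_scalar_ac flip: scalar_matrix_assoc)
  finally have "\<mu> *\<^sub>R mat 1 = \<mu> *\<^sub>R (inverse \<mu> *\<^sub>R matrix_inv ?T
      - (inverse \<mu> * inverse \<mu>) *\<^sub>R (matrix_inv ?T ** ?S))"
    by (simp only: matrix_inv_mult[OF T])
  then have "\<mu> *\<^sub>R mat 1 = matrix_inv ?T - inverse \<mu> *\<^sub>R (matrix_inv ?T ** ?S)"
    using assms(2) by (simp add: scaleR_diff_right)
  then have R': "resolvent_average (inverse \<mu>) n (\<lambda>i. matrix_inv (A i)) l =
      inverse \<mu> *\<^sub>R (matrix_inv ?T ** ?S)"
    by (simp add: resolvent_average_def)
  \<comment> \<open>The inner pair cancels first, then the outer one; the scalars
    \<open>\<mu>\<close> and \<open>inverse \<mu>\<close> cancel as well.\<close>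
  have "(matrix_inv ?S ** ?T) ** (matrix_inv ?T ** ?S) =
      matrix_inv ?S ** (?T ** matrix_inv ?T) ** ?S"
    by (simp add: matrix_mul_assoc)
  also have "\<dots> = mat 1"
    by (simp add: matrix_inv_mult S T)
  finally show ?thesis
    using assms(2) by (simp add: R R' matrix_scalar_ac flip: scalar_matrix_assoc)
qed

theorem theorem4p7:
  fixes A :: "nat \<Rightarrow> real^'N^'N" and l :: "nat \<Rightarrow> real" and \<mu> :: real and n :: nat
  assumes "n \<ge> 1"
    and "\<And>i. i \<in> {1..n} \<Longrightarrow> A i \<in> pos_def_matrices"
    and "\<mu> > 0"
    and "\<And>i. i \<in> {1..n} \<Longrightarrow> l i > 0"
    and "(\<Sum>i = 1..n. l i) = 1"
  shows "(\<forall>i\<in>{1..n}. invertible (A i)) \<and>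
         (resolvent_average_exists \<mu> n A l) \<and>
         (resolvent_average_exists (inverse \<mu>) n (\<lambda>i. matrix_inv (A i)) l) \<and>
         (invertible (resolvent_average \<mu> n A l)) \<and>
         (matrix_inv (resolvent_average \<mu> n A l) =
           resolvent_average (inverse \<mu>) n (\<lambda>i. matrix_inv (A i)) l) \<and>
         (matrix_inv (matrix_inv (\<Sum>i = 1..n. l i *\<^sub>R matrix_inv (A i + inverse \<mu> *\<^sub>R mat 1))
             - inverse \<mu> *\<^sub>R mat 1) =
           matrix_inv (\<Sum>i = 1..n. l i *\<^sub>R matrix_inv (matrix_inv (A i) + \<mu> *\<^sub>R mat 1))
             - \<mu> *\<^sub>R mat 1) \<and>
         (matrix_inv (resolvent_average 1 n A l) =
           resolvent_average 1 n (\<lambda>i. matrix_inv (A i)) l)"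
proof -
  let ?B = "\<lambda>i. matrix_inv (A i)"
  have inv: "\<forall>i\<in>{1..n}. invertible (A i)"
    using assms(2) pos_def_matrices_invertible by blast
  have exA: "resolvent_average_exists \<mu> n A l"
    using assms by (intro resolvent_average_exists_pos_def) auto
  have exB: "resolvent_average_exists (inverse \<mu>) n ?B l"
    using assms by (intro resolvent_average_exists_pos_def pos_def_matrices_matrix_inv) auto
  \<comment> \<open>Kept general in \<open>m\<close> to serve both \<open>\<mu>\<close> and 1, where
    \<open>inverse 1 = 1\<close>.\<close>
  have mult: "resolvent_average m n A l ** resolvent_average (inverse m) n ?B l = mat 1"
    if "m > 0" for m
    using assms that by (intro resolvent_average_mult) auto
  note R = invertible_matrix_inv_eqI[OF mult[OF assms(3)]]
  have one: "matrix_inv (resolvent_average 1 n A l) = resolvent_average 1 n ?B l"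
    using invertible_matrix_inv_eqI(2)[OF mult[of 1]] by simp
  show ?thesis
    using inv exA exB R one
      R(2)[unfolded resolvent_average_def weighted_resolvent_sum_def inverse_inverse_eq]
    by blast
qed

end
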